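(* Suppose $\mathcal{A}$ is a sequentially correct implementation of a 1-bit max register in the asynchronous CRQW model that uses $M$ machine words in the shared memory, and for any execution of at most $P$ operations under one-shot inputs, every $\mathbf{set}$ operation completes within $L \in \Omega(\log P)$ timesteps with high probability in $P$. Then there exists a one-shot input in which some $\mathbf{set}$ operation has expected latency $\Omega(\log_{ML} P)$. In particular, if $M, L \le \operatorname{polylog} P$, then the expected latency becomes $\Omega(\log P/\log\log P)$.
   Context: **1-bit max register.** An object storing a bit $x$, initially $0$, with operations $\mathbf{read}$ (returns the current $x$) and $\mathbf{set}$ (sets $x$ to $1$). **Sequential correctness.** If at every time in the execution there is at most one ongoing operation (invoked but not yet returned), then the data structure behaves correctly. (Linearizability is not required.) **Asynchronous CRQW model.** There are $P$ processes, $[P]=\{1,\dots,P\}$, each with a local memory, and a shared memory of machine words (cells); each shared cell $C$ has an instruction queue $Q_C$. Executions proceed in discrete timesteps; time $t$ is the moment immediately before timestep $t$. Shared instructions are either state-changing (may alter shared memory, e.g. $\mathtt{store}$, $\mathtt{CAS}$) or non-state-changing (e.g. $\mathtt{load}$). Local and non-state-changing instructions are applied in the timestep in which they are invoked. A state-changing instruction on cell $C$ is appended to $Q_C$ upon invocation (those invoked in the same timestep on the same cell are added in adversarial order); after all invocations in a timestep, for each nonempty $Q_C$ the head instruction is dequeued and applied, its effect visible at the next time. A process with an invoked instruction still in a queue is waiting, otherwise it is ready. In every timestep, every ready process (with an instruction to run) is scheduled and invokes its next instruction. Processes may use private independent randomness, and each operation knows the index of the process running it. **One-shot input.** The user invokes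 operations only in the first timestep of the execution (at most one per process); these are fixed in advance. **Latency and high probability.** The latency of an operation is the time between its invocation and its response. An event holds with high probability in $P$ if its probability is at least $1-1/\mathrm{poly}(P)$, where $\mathrm{poly}(P)=P^{\kappa}$ for a sufficiently large constant $\kappa$. *)

theory Defs
  imports "HOL-Probability.Probability" "HOL-Library.Landau_Symbols"
begin

section \<open>Asynchronous CRQW implementations of a 1-bit max register\<close>

datatype operation = Read_Op | Set_Op

text \<open>
  \<^item> \<open>'s\<close>: contents of the local memory of a process; \<open>'w\<close>: machine words.
  \<^item> \<open>Update c f k\<close> is a state-changing instruction on cell \<open>c\<close>: when it is applied to the
    contents \<open>w\<close>, the cell becomes \<open>f w\<close> and the local memory of the process becomes \<open>k w\<close>.
    A store of \<open>v\<close> has \<open>f = (\<lambda>_. v)\<close>, a CAS has \<open>f = (\<lambda>w. if w = a then b else w)\<close>.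
    It counts as state-changing even when \<open>f\<close> leaves the cell unchanged.
  \<^item> \<open>Return b s\<close> is the local instruction that ends the operation with response \<open>b\<close>
    (meaningless for a set); \<open>s\<close> is the local memory kept for later operations.
\<close>
datatype ('s, 'w) instr =
    Local 's
  | Load nat "'w \<Rightarrow> 's"
  | Update nat "'w \<Rightarrow> 'w" "'w \<Rightarrow> 's"
  | Return bool 's

text \<open>
  All the code of process \<open>p\<close> is in \<open>next_instr p\<close>, which maps the local memory and a fresh random
  value, distributed as \<open>coin p\<close>, to the next instruction. \<open>start p\<close> puts an invoked operation
  into the local memory.
\<close>
record ('s, 'w, 'r) implementation =
  init_mem   :: "nat \<Rightarrow> 'w"
  init_local :: "nat \<Rightarrow> 's"
  start      :: "nat \<Rightarrow> operation \<Rightarrow> 's \<Rightarrow> 's"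
  next_instr :: "nat \<Rightarrow> 's \<Rightarrow> 'r \<Rightarrow> ('s, 'w) instr"
  coin       :: "nat \<Rightarrow> 'r pmf"

text \<open>The shared memory consists of the cells \<open>0, \<dots>, M - 1\<close>.\<close>
definition uses_words :: "nat \<Rightarrow> nat \<Rightarrow> ('s, 'w, 'r) implementation \<Rightarrow> bool" where
  "uses_words P M A \<longleftrightarrow>
     (\<forall>p\<in>{1..P}. \<forall>s. \<forall>r\<in>set_pmf (coin A p).
        case next_instr A p s r of
          Load c k \<Rightarrow> c < M
        | Update c f k \<Rightarrow> c < M
        | _ \<Rightarrow> True)"


section \<open>Executions\<close>

text \<open>
  \<open>Idle\<close>: no ongoing operation. \<open>Ready\<close> and \<open>Waiting\<close>: inside an operation.
  \<open>Waiting c k\<close>: an update of cell \<open>c\<close> with continuation \<open>k\<close> is still in the queue of \<open>c\<close>.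
\<close>
datatype ('s, 'w) status = Idle 's | Ready 's | Waiting nat "'w \<Rightarrow> 's"

record ('s, 'w) config =
  mem    :: "nat \<Rightarrow> 'w"
  queue  :: "nat \<Rightarrow> (nat \<times> ('w \<Rightarrow> 'w)) list"
  status :: "nat \<Rightarrow> ('s, 'w) status"

definition init_config :: "('s, 'w, 'r) implementation \<Rightarrow> ('s, 'w) config" where
  "init_config A = \<lparr>mem = init_mem A, queue = (\<lambda>c. []), status = (\<lambda>p. Idle (init_local A p))\<rparr>"

text \<open>\<open>I t p\<close> is the operation that the user invokes at process \<open>p\<close> in timestep \<open>t\<close>, if any.\<close>
type_synonym user_input = "nat \<Rightarrow> nat \<Rightarrow> operation option"

text \<open>
  Given the configurations at the times \<open>0, \<dots>, t\<close> and the instructions invoked in timestep \<open>t\<close>, the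
  adversary chooses for every cell a priority for each process. Updates of that cell invoked in
  timestep \<open>t\<close> are enqueued in increasing order of priority (ties by index), so every order
  of the newly invoked updates can be chosen. Results are relative to a nonempty set \<open>Adv\<close> of
  adversaries: all functions of this type form the adaptive adversary, those that ignore their
  first two arguments (except for the length of the first) the oblivious one.
\<close>
type_synonym ('s, 'w) adversary =
  "('s, 'w) config list \<Rightarrow> (nat \<Rightarrow> ('s, 'w) instr option) \<Rightarrow> nat \<Rightarrow> nat \<Rightarrow> nat"

definition status_inv ::
  "('s, 'w, 'r) implementation \<Rightarrow> (nat \<Rightarrow> operation option) \<Rightarrow> ('s, 'w) config \<Rightarrow> nat \<Rightarrow> ('s, 'w) status" where
  "status_inv A i C p =
     (case (status C p, i p) of
        (Idle s, Some op) \<Rightarrow> Ready (start A p op s)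
      | (x, _) \<Rightarrow> x)"

definition invoked ::
  "nat \<Rightarrow> ('s, 'w, 'r) implementation \<Rightarrow> (nat \<Rightarrow> operation option) \<Rightarrow> (nat \<Rightarrow> 'r) \<Rightarrow> ('s, 'w) config
     \<Rightarrow> nat \<Rightarrow> ('s, 'w) instr option" where
  "invoked P A i r C p =
     (if p \<in> {1..P} then
        (case status_inv A i C p of
           Ready s \<Rightarrow> Some (next_instr A p s (r p))
         | _ \<Rightarrow> None)
      else None)"

definition new_updates ::
  "nat \<Rightarrow> (nat \<Rightarrow> nat) \<Rightarrow> (nat \<Rightarrow> ('s, 'w) instr option) \<Rightarrow> nat \<Rightarrow> (nat \<times> ('w \<Rightarrow> 'w)) list" where
  "new_updates P prio ins c =
     concat (map (\<lambda>p. case ins p of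
                        Some (Update c' f k) \<Rightarrow> if c' = c then [(p, f)] else []
                      | _ \<Rightarrow> [])
       (sort_key prio [1..<Suc P]))"

text \<open>
  Loads read \<open>mem C\<close>, the memory at the beginning of the timestep. The head of a queue is applied
  after the instructions invoked in the same timestep have been enqueued.
\<close>
definition timestep ::
  "nat \<Rightarrow> ('s, 'w, 'r) implementation \<Rightarrow> ((nat \<Rightarrow> ('s, 'w) instr option) \<Rightarrow> nat \<Rightarrow> nat \<Rightarrow> nat)
     \<Rightarrow> (nat \<Rightarrow> operation option) \<Rightarrow> (nat \<Rightarrow> 'r) \<Rightarrow> ('s, 'w) config \<Rightarrow> ('s, 'w) config" where
  "timestep P A prio i r C =
     (let ins = invoked P A i r C;
          q = (\<lambda>c. queue C c @ new_updates P (prio ins c) ins c);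
          st = (\<lambda>p. case ins p of
                      None \<Rightarrow> status_inv A i C p
                    | Some (Local s) \<Rightarrow> Ready s
                    | Some (Load c k) \<Rightarrow> Ready (k (mem C c))
                    | Some (Update c f k) \<Rightarrow> Waiting c k
                    | Some (Return b s) \<Rightarrow> Idle s)
      in \<lparr>mem = (\<lambda>c. case q c of [] \<Rightarrow> mem C c | (p, f) # _ \<Rightarrow> f (mem C c)),
          queue = (\<lambda>c. tl (q c)),
          status = (\<lambda>p. case st p of
                          Waiting c k \<Rightarrow>
                            if q c \<noteq> [] \<and> fst (hd (q c)) = p then Ready (k (mem C c))
                            else Waiting c k
                        | x \<Rightarrow> x)\<rparr>)"

text \<open>
  \<open>\<omega> (p, t)\<close> is the random value available to process \<open>p\<close> in timestep \<open>t\<close>.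
  \<open>history\<close> lists the configurations at the times \<open>0, \<dots>, t\<close>.
\<close>
primrec history ::
  "nat \<Rightarrow> ('s, 'w, 'r) implementation \<Rightarrow> ('s, 'w) adversary \<Rightarrow> user_input \<Rightarrow> (nat \<times> nat \<Rightarrow> 'r)
     \<Rightarrow> nat \<Rightarrow> ('s, 'w) config list" where
  "history P A adv I \<omega> 0 = [init_config A]"
| "history P A adv I \<omega> (Suc t) =
     (let h = history P A adv I \<omega> t
      in h @ [timestep P A (adv h) (I t) (\<lambda>p. \<omega> (p, t)) (last h)])"

definition config_at ::
  "nat \<Rightarrow> ('s, 'w, 'r) implementation \<Rightarrow> ('s, 'w) adversary \<Rightarrow> user_input \<Rightarrow> (nat \<times> nat \<Rightarrow> 'r)
     \<Rightarrow> nat \<Rightarrow> ('s, 'w) config" where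
  "config_at P A adv I \<omega> t = last (history P A adv I \<omega> t)"

text \<open>
  The random values are independent over processes and timesteps. Their distribution does not depend
  on the timestep, so they carry no information about the time.
\<close>
definition coin_space :: "nat \<Rightarrow> ('s, 'w, 'r) implementation \<Rightarrow> (nat \<times> nat \<Rightarrow> 'r) measure" where
  "coin_space P A = PiM ({1..P} \<times> UNIV) (\<lambda>(p, t). measure_pmf (coin A p))"


section \<open>Sequential correctness\<close>

definition is_idle :: "('s, 'w) status \<Rightarrow> bool" where
  "is_idle x \<longleftrightarrow> (\<exists>s. x = Idle s)"

text \<open>The second conjunct excludes an invocation at a process whose operation is still ongoing.\<close>
definition sequential_execution ::
  "nat \<Rightarrow> ('s, 'w, 'r) implementation \<Rightarrow> ('s, 'w) adversary \<Rightarrow> user_input \<Rightarrow> (nat \<times> nat \<Rightarrow> 'r) \<Rightarrow> bool" where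
  "sequential_execution P A adv I \<omega> \<longleftrightarrow>
     (\<forall>t. let C = config_at P A adv I \<omega> t in
        (\<forall>p\<in>{1..P}. \<forall>q\<in>{1..P}.
            \<not> is_idle (status_inv A (I t) C p) \<and> \<not> is_idle (status_inv A (I t) C q) \<longrightarrow> p = q) \<and>
        (\<forall>p\<in>{1..P}. I t p \<noteq> None \<longrightarrow> is_idle (status C p)))"

definition responds ::
  "nat \<Rightarrow> ('s, 'w, 'r) implementation \<Rightarrow> ('s, 'w) adversary \<Rightarrow> user_input \<Rightarrow> (nat \<times> nat \<Rightarrow> 'r)
     \<Rightarrow> nat \<Rightarrow> nat \<Rightarrow> bool \<Rightarrow> bool" where
  "responds P A adv I \<omega> t p b \<longleftrightarrow>
     (\<exists>s. invoked P A (I t) (\<lambda>p. \<omega> (p, t)) (config_at P A adv I \<omega> t) p = Some (Return b s))"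

text \<open>
  In a sequential execution all earlier operations have returned when a read is invoked, so the bit
  is 1 iff some set has been invoked before. Every operation has to return.
\<close>
definition correct_execution ::
  "nat \<Rightarrow> ('s, 'w, 'r) implementation \<Rightarrow> ('s, 'w) adversary \<Rightarrow> user_input \<Rightarrow> (nat \<times> nat \<Rightarrow> 'r) \<Rightarrow> bool" where
  "correct_execution P A adv I \<omega> \<longleftrightarrow>
     (\<forall>t. \<forall>p\<in>{1..P}. \<forall>op. I t p = Some op \<longrightarrow>
        (\<exists>t'\<ge>t. \<exists>b. responds P A adv I \<omega> t' p b \<and>
           (\<forall>u\<in>{t..<t'}. \<forall>b'. \<not> responds P A adv I \<omega> u p b') \<and>
           (op = Read_Op \<longrightarrow> (b \<longleftrightarrow> (\<exists>u<t. \<exists>q\<in>{1..P}. I u q = Some Set_Op)))))"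

definition sequentially_correct ::
  "nat \<Rightarrow> ('s, 'w) adversary set \<Rightarrow> ('s, 'w, 'r) implementation \<Rightarrow> bool" where
  "sequentially_correct P Adv A \<longleftrightarrow>
     (\<forall>adv\<in>Adv. \<forall>I. AE \<omega> in coin_space P A.
        sequential_execution P A adv I \<omega> \<longrightarrow> correct_execution P A adv I \<omega>)"


section \<open>Latency under one-shot inputs\<close>

definition one_shot :: "(nat \<Rightarrow> operation option) \<Rightarrow> user_input" where
  "one_shot i = (\<lambda>t. if t = 0 then i else (\<lambda>p. None))"

text \<open>
  The invocation is at time 0; a response in timestep \<open>t\<close> gives latency \<open>t + 1\<close>.
  The latency is \<open>\<infinity>\<close> if there is no response.
\<close>
definition latency ::
  "nat \<Rightarrow> ('s, 'w, 'r) implementation \<Rightarrow> ('s, 'w) adversary \<Rightarrow> (nat \<Rightarrow> operation option)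
     \<Rightarrow> (nat \<times> nat \<Rightarrow> 'r) \<Rightarrow> nat \<Rightarrow> enat" where
  "latency P A adv i \<omega> p =
     Inf {enat (Suc t) | t. \<exists>b. responds P A adv (one_shot i) \<omega> t p b}"

definition expected_latency ::
  "nat \<Rightarrow> ('s, 'w, 'r) implementation \<Rightarrow> ('s, 'w) adversary \<Rightarrow> (nat \<Rightarrow> operation option) \<Rightarrow> nat \<Rightarrow> ennreal" where
  "expected_latency P A adv i p =
     (\<integral>\<^sup>+ \<omega>. ennreal_of_enat (latency P A adv i \<omega> p) \<partial>coin_space P A)"

text \<open>Each single set completes within \<open>L\<close> timesteps with probability at least \<open>1 - 1 / P powr \<kappa>\<close>.\<close>
definition sets_complete_whp ::
  "real \<Rightarrow> nat \<Rightarrow> ('s, 'w) adversary set \<Rightarrow> nat \<Rightarrow> ('s, 'w, 'r) implementation \<Rightarrow> bool" where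
  "sets_complete_whp \<kappa> P Adv L A \<longleftrightarrow>
     (\<forall>adv\<in>Adv. \<forall>i. \<forall>p\<in>{1..P}. i p = Some Set_Op \<longrightarrow>
        measure (coin_space P A) {\<omega> \<in> space (coin_space P A). latency P A adv i \<omega> p \<le> enat L}
          \<ge> 1 - 1 / real P powr \<kappa>)"

definition some_set_expected_latency_ge ::
  "nat \<Rightarrow> ('s, 'w) adversary set \<Rightarrow> ('s, 'w, 'r) implementation \<Rightarrow> real \<Rightarrow> bool" where
  "some_set_expected_latency_ge P Adv A b \<longleftrightarrow>
     (\<exists>i. \<exists>p\<in>{1..P}. i p = Some Set_Op \<and>
        (\<forall>adv\<in>Adv. expected_latency P A adv i p \<ge> ennreal b))"

end

theory Submission
  imports Defs
begin

text \<open>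
  Follow a set by \<open>p\<close> on shared memory that nobody else touches, and let \<open>F t p\<close> be the probability
  that it has invoked a state-changing instruction before time \<open>t\<close>. If the processes of \<open>S\<close> all set
  and \<open>(\<Sum>p\<in>S. F t p) \<le> 1 / 2\<close>, then with probability at least \<open>1 / 2\<close> none of them notices the
  others before time \<open>t\<close>, and those that update in timestep \<open>t\<close> must all be served within \<open>L\<close>
  timesteps with high probability. As \<open>M\<close> cells serve at most \<open>M * L\<close> updates in that time,
  \<open>(\<Sum>p\<in>S. F (t + 1) p) = O(M * L)\<close>, and keeping the fraction of order \<open>1 / (M * L)\<close> of \<open>S\<close> with
  the smallest values restores the bound \<open>1 / 2\<close>. Hence after \<open>\<Omega>(log P / log (M * L))\<close> timesteps
  some process is left that, when it runs alone, has not updated with probability at least \<open>1 / 2\<close>.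
  By sequential correctness it cannot return before it has updated.
\<close>

section \<open>Solo runs of a set on untouched memory\<close>

definition solo_step ::
  "('s, 'w, 'r) implementation \<Rightarrow> nat \<Rightarrow> 'r \<Rightarrow> ('s, 'w) status \<Rightarrow> ('s, 'w) status" where
  "solo_step A p x st =
     (case st of
        Ready s \<Rightarrow> (case next_instr A p s x of
                      Local s' \<Rightarrow> Ready s'
                    | Load c k \<Rightarrow> Ready (k (init_mem A c))
                    | Update c f k \<Rightarrow> Waiting c k
                    | Return b s' \<Rightarrow> Idle s')
      | _ \<Rightarrow> st)"

primrec solo ::
  "('s, 'w, 'r) implementation \<Rightarrow> nat \<Rightarrow> (nat \<Rightarrow> 'r) \<Rightarrow> nat \<Rightarrow> ('s, 'w) status" where
  "solo A p r 0 = Ready (start A p Set_Op (init_local A p))"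
| "solo A p r (Suc t) = solo_step A p (r t) (solo A p r t)"

definition is_waiting :: "('s, 'w) status \<Rightarrow> bool" where
  "is_waiting x \<longleftrightarrow> (\<exists>c k. x = Waiting c k)"

text \<open>In \<open>solo\<close> a status \<open>Waiting\<close> is never left, since no update is
  ever applied there. Hence being in it at time \<open>t\<close> records that an update was invoked
  in some timestep before \<open>t\<close>. The event depends on the coins of \<open>p\<close>
  alone.\<close>

definition has_updated ::
  "('s, 'w, 'r) implementation \<Rightarrow> nat \<Rightarrow> nat \<Rightarrow> (nat \<times> nat \<Rightarrow> 'r) \<Rightarrow> bool" where
  "has_updated A p t \<omega> \<longleftrightarrow> is_waiting (solo A p (\<lambda>u. \<omega> (p, u)) t)"

definition set_input :: "nat set \<Rightarrow> nat \<Rightarrow> operation option" where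
  "set_input S = (\<lambda>p. if p \<in> S then Some Set_Op else None)"

lemma has_updated_0 [simp]: "\<not> has_updated A p 0 \<omega>"
  by (simp add: has_updated_def is_waiting_def)

lemma has_updated_Suc: "has_updated A p t \<omega> \<Longrightarrow> has_updated A p (Suc t) \<omega>"
  by (auto simp: has_updated_def is_waiting_def solo_step_def)

lemma has_updated_mono: "t \<le> u \<Longrightarrow> has_updated A p t \<omega> \<Longrightarrow> has_updated A p u \<omega>"
  by (induction u rule: dec_induct) (auto intro: has_updated_Suc)

lemma solo_Idle_mono: "t \<le> u \<Longrightarrow> solo A p r t = Idle s \<Longrightarrow> solo A p r u = Idle s"
  by (induction u rule: dec_induct) (auto simp: solo_step_def)

lemma config_at_0 [simp]: "config_at P A adv I \<omega> 0 = init_config A"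
  by (simp add: config_at_def)

lemma config_at_Suc:
  "config_at P A adv I \<omega> (Suc t) =
     timestep P A (adv (history P A adv I \<omega> t)) (I t) (\<lambda>p. \<omega> (p, t)) (config_at P A adv I \<omega> t)"
  by (simp add: config_at_def Let_def)

section \<open>Concurrent sets before the first update\<close>

text \<open>Time 0 is separate because the invocation takes place within timestep 0, so the status
  is still \<open>Idle\<close>, whereas \<open>solo\<close> at 0 has \<open>start\<close> applied
  already.\<close>

definition quiet_config ::
  "('s, 'w, 'r) implementation \<Rightarrow> nat set \<Rightarrow> (nat \<times> nat \<Rightarrow> 'r) \<Rightarrow> nat \<Rightarrow> ('s, 'w) config" where
  "quiet_config A S \<omega> t =
     \<lparr>mem = init_mem A, queue = (\<lambda>c. []),
      status = (\<lambda>p. if t = 0 \<or> p \<notin> S then Idle (init_local A p) else solo A p (\<lambda>u. \<omega> (p, u)) t)\<rparr>"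

lemma status_inv_quiet:
  assumes "i = (if t = 0 then set_input S else (\<lambda>_. None))"
  shows "status_inv A i (quiet_config A S \<omega> t) p =
    (if p \<in> S then solo A p (\<lambda>u. \<omega> (p, u)) t else Idle (init_local A p))"
  using assms by (auto simp: status_inv_def quiet_config_def set_input_def split: status.splits)

lemma invoked_quiet:
  assumes "i = (if t = 0 then set_input S else (\<lambda>_. None))" "S \<subseteq> {1..P}"
  shows "invoked P A i r (quiet_config A S \<omega> t) p =
    (if p \<in> S then (case solo A p (\<lambda>u. \<omega> (p, u)) t of
        Ready s \<Rightarrow> Some (next_instr A p s (r p)) | _ \<Rightarrow> None) else None)"
  using assms(2) by (auto simp: invoked_def status_inv_quiet[OF assms(1)])

text \<open>Without updates the queues stay empty and the cells keep their initial contents. So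
  every process of \<open>S\<close> loads what it loads in its solo run, and \<open>prio\<close> has
  nothing to order.\<close>

lemma timestep_quiet:
  assumes i: "i = (if t = 0 then set_input S else (\<lambda>_. None))" and S: "S \<subseteq> {1..P}"
    and no: "\<And>p. p \<in> S \<Longrightarrow> \<not> has_updated A p (Suc t) \<omega>"
  shows "timestep P A prio i (\<lambda>p. \<omega> (p, t)) (quiet_config A S \<omega> t) = quiet_config A S \<omega> (Suc t)"
proof -
  let ?C = "quiet_config A S \<omega> t"
  define ins where "ins = invoked P A i (\<lambda>p. \<omega> (p, t)) ?C"
  have ins: "ins p = (if p \<in> S then (case solo A p (\<lambda>u. \<omega> (p, u)) t of
        Ready s \<Rightarrow> Some (next_instr A p s (\<omega> (p, t))) | _ \<Rightarrow> None) else None)" for p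
    unfolding ins_def by (rule invoked_quiet[OF i S])
  have noupd: "ins p \<noteq> Some (Update c f k)" for p c f k
    using no[of p] by (auto simp: ins has_updated_def is_waiting_def solo_step_def split: status.splits if_splits)
  have new: "new_updates P pr ins c = []" for pr c
    using noupd by (auto simp: new_updates_def split: option.splits instr.splits)
  have nowait: "solo A p (\<lambda>u. \<omega> (p, u)) t \<noteq> Waiting c k" if "p \<in> S" for p c k
    using no[OF that] has_updated_Suc[of A p t \<omega>] by (auto simp: has_updated_def is_waiting_def)
  have q: "queue ?C c = []" and m: "mem ?C = init_mem A" for c
    by (simp_all add: quiet_config_def)
  show ?thesis
    unfolding timestep_def Let_def ins_def[symmetric] new q m status_inv_quiet[OF i]
    using noupd nowait
    by (auto simp: quiet_config_def ins solo_step_def fun_eq_iff split: status.splits instr.splits option.splits)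
qed

text \<open>The input is constrained only before time \<open>t\<close>, so that this covers both the
  one-shot inputs and \<open>set_then_read\<close> up to its read.\<close>

lemma config_at_quiet:
  assumes S: "S \<subseteq> {1..P}"
    and I: "\<And>v. v < t \<Longrightarrow> I v = (if v = 0 then set_input S else (\<lambda>_. None))"
    and no: "\<And>p. p \<in> S \<Longrightarrow> \<not> has_updated A p t \<omega>"
  shows "config_at P A adv I \<omega> t = quiet_config A S \<omega> t"
  using I no
proof (induction t)
  case 0
  then show ?case by (simp add: init_config_def quiet_config_def)
next
  case (Suc t)
  have "config_at P A adv I \<omega> t = quiet_config A S \<omega> t"
    using Suc.IH Suc.prems has_updated_Suc by (metis less_SucI)
  then show ?case
    unfolding config_at_Suc using Suc.prems by (simp add: timestep_quiet[OF _ S])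
qed

lemma latency_ge:
  assumes "\<And>u b. u < n \<Longrightarrow> \<not> responds P A adv (one_shot i) \<omega> u p b"
  shows "enat (Suc n) \<le> latency P A adv i \<omega> p"
  unfolding latency_def by (rule Inf_greatest) (use assms not_less in \<open>auto; blast\<close>)

lemma one_shot_set_input:
  "one_shot (set_input S) t = (if t = 0 then set_input S else (\<lambda>_. None))"
  by (simp add: one_shot_def)

text \<open>A response in timestep \<open>t\<close> is determined by the configuration at time
  \<open>t\<close> and the coin of \<open>p\<close>. Hence updates are excluded only before time
  \<open>t\<close>, and other processes may well update in timestep \<open>t\<close> itself.\<close>

lemma responds_quiet:
  assumes S: "S \<subseteq> {1..P}" and p: "p \<in> S"
    and I: "\<And>v. v \<le> t \<Longrightarrow> I v = (if v = 0 then set_input S else (\<lambda>_. None))"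
    and no: "\<And>p. p \<in> S \<Longrightarrow> \<not> has_updated A p t \<omega>"
    and resp: "responds P A adv I \<omega> t p b"
  shows "is_idle (solo A p (\<lambda>u. \<omega> (p, u)) (Suc t))"
proof -
  have "config_at P A adv I \<omega> t = quiet_config A S \<omega> t"
    by (rule config_at_quiet[OF S]) (use I no in auto)
  then show ?thesis
    using resp p unfolding responds_def
    by (auto simp: invoked_quiet[OF I[of t, simplified] S] is_idle_def solo_step_def
        split: status.splits)
qed

section \<open>Counting the updates served within \<open>L\<close> timesteps\<close>

text \<open>Arbitrary (\<open>hd []\<close>) if no update of cell \<open>c\<close> is pending.\<close>
definition served ::
  "nat \<Rightarrow> ('s, 'w, 'r) implementation \<Rightarrow> ('s, 'w) adversary \<Rightarrow> user_input \<Rightarrow> (nat \<times> nat \<Rightarrow> 'r)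
     \<Rightarrow> nat \<Rightarrow> nat \<Rightarrow> nat" where
  "served P A adv I \<omega> t c =
     (let C = config_at P A adv I \<omega> t;
          ins = invoked P A (I t) (\<lambda>p. \<omega> (p, t)) C
      in fst (hd (queue C c @ new_updates P (adv (history P A adv I \<omega> t) ins c) ins c)))"

lemma status_Suc_update:
  assumes "invoked P A (I t) (\<lambda>p. \<omega> (p, t)) (config_at P A adv I \<omega> t) p = Some (Update c f k)"
    and "served P A adv I \<omega> t c \<noteq> p"
  shows "status (config_at P A adv I \<omega> (Suc t)) p = Waiting c k"
  using assms unfolding config_at_Suc timestep_def Let_def by (simp add: served_def Let_def)

lemma status_Suc_waiting:
  assumes st: "status (config_at P A adv I \<omega> t) p = Waiting c k"
    and "served P A adv I \<omega> t c \<noteq> p"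
  shows "status (config_at P A adv I \<omega> (Suc t)) p = Waiting c k"
proof -
  have sti: "status_inv A (I t) (config_at P A adv I \<omega> t) p = Waiting c k"
    by (simp add: status_inv_def st)
  moreover have "invoked P A (I t) (\<lambda>p. \<omega> (p, t)) (config_at P A adv I \<omega> t) p = None"
    by (simp add: invoked_def sti)
  ultimately show ?thesis
    using assms(2) unfolding config_at_Suc timestep_def Let_def by (simp add: served_def Let_def)
qed

lemma stays_waiting:
  assumes w: "status (config_at P A adv I \<omega> t) p = Waiting c k" and "t \<le> u"
    and np: "\<And>v. t \<le> v \<Longrightarrow> v < u \<Longrightarrow> served P A adv I \<omega> v c \<noteq> p"
  shows "status (config_at P A adv I \<omega> u) p = Waiting c k"
  using \<open>t \<le> u\<close> np
  by (induction u rule: dec_induct) (simp_all add: w status_Suc_waiting)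

lemma not_responds_waiting:
  assumes "status (config_at P A adv I \<omega> t) p = Waiting c k"
  shows "\<not> responds P A adv I \<omega> t p b"
  using assms by (simp add: responds_def invoked_def status_inv_def)

text \<open>Up to timestep \<open>t\<close> the execution is quiet, and \<open>p\<close> cannot
  return because its solo run is about to update. After that \<open>p\<close> waits in the queue of
  its cell until it is served. If this does not happen in a timestep below \<open>L\<close>, then no
  response occurs in those timesteps and the latency is at least \<open>L + 1\<close>.\<close>

lemma updater_served:
  assumes S: "S \<subseteq> {1..P}" and p: "p \<in> S"
    and words: "uses_words P M A" and coin: "\<omega> (p, t) \<in> set_pmf (coin A p)"
    and no: "\<And>p. p \<in> S \<Longrightarrow> \<not> has_updated A p t \<omega>"
    and lat: "latency P A adv (set_input S) \<omega> p \<le> enat L"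
    and upd: "has_updated A p (Suc t) \<omega>"
  shows "\<exists>u<L. \<exists>c<M. served P A adv (one_shot (set_input S)) \<omega> u c = p"
proof (rule ccontr)
  let ?I = "one_shot (set_input S)"
  let ?r = "\<lambda>u. \<omega> (p, u)"
  assume "\<not> ?thesis"
  then have nos: "served P A adv ?I \<omega> u c \<noteq> p" if "u < L" "c < M" for u c
    using that by blast
  have not_idle: "\<not> is_idle (solo A p ?r (Suc v))" if "v \<le> t" for v
    using upd solo_Idle_mono[of "Suc v" "Suc t" A p ?r] that
    by (auto simp: is_idle_def has_updated_def is_waiting_def simp del: solo.simps)
  obtain s c f k where s: "solo A p ?r t = Ready s" and ins: "next_instr A p s (\<omega> (p, t)) = Update c f k"
    using upd no[OF p] unfolding has_updated_def is_waiting_def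
    by (auto simp: solo_step_def split: status.splits instr.splits)
  have "p \<in> {1..P}" using S p by blast
  then have "c < M"
    using words[unfolded uses_words_def, rule_format, of p "\<omega> (p, t)" s] coin by (simp add: ins)
  have early: "\<not> responds P A adv ?I \<omega> v p b" if "v \<le> t" for v b
  proof
    assume "responds P A adv ?I \<omega> v p b"
    then have "is_idle (solo A p ?r (Suc v))"
      by (rule responds_quiet[OF S p, rotated 2])
        (use that no has_updated_mono[of v t] in \<open>auto simp: one_shot_set_input\<close>)
    with not_idle that show False by blast
  qed
  have late: "\<not> responds P A adv ?I \<omega> v p b" if "t < v" "v < L" for v b
  proof (rule not_responds_waiting)
    have conf: "config_at P A adv ?I \<omega> t = quiet_config A S \<omega> t"
      by (rule config_at_quiet[OF S]) (use no in \<open>auto simp: one_shot_set_input\<close>)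
    have "invoked P A (?I t) (\<lambda>p. \<omega> (p, t)) (config_at P A adv ?I \<omega> t) p = Some (Update c f k)"
      unfolding conf by (subst invoked_quiet[OF one_shot_set_input S]) (simp add: p s ins)
    then have "status (config_at P A adv ?I \<omega> (Suc t)) p = Waiting c k"
      by (rule status_Suc_update) (use nos that \<open>c < M\<close> in auto)
    then show "status (config_at P A adv ?I \<omega> v) p = Waiting c k"
      by (rule stays_waiting) (use nos that \<open>c < M\<close> in auto)
  qed
  have "enat (Suc L) \<le> latency P A adv (set_input S) \<omega> p"
    using early late by (intro latency_ge) (meson not_le)
  with lat have "enat (Suc L) \<le> enat L" by (rule order_trans[rotated])
  then show False by simp
qed

text \<open>Each pair of a timestep and a cell names one process by \<open>served\<close>, and every
  updater is named by some pair. Arbitrary values of \<open>served\<close> at empty queues do no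
  harm to an upper bound.\<close>

lemma card_updaters_le:
  assumes S: "S \<subseteq> {1..P}"
    and words: "uses_words P M A" and coin: "\<And>p. p \<in> S \<Longrightarrow> \<omega> (p, t) \<in> set_pmf (coin A p)"
    and no: "\<And>p. p \<in> S \<Longrightarrow> \<not> has_updated A p t \<omega>"
    and lat: "\<And>p. p \<in> S \<Longrightarrow> latency P A adv (set_input S) \<omega> p \<le> enat L"
  shows "card {p \<in> S. has_updated A p (Suc t) \<omega>} \<le> M * L"
proof -
  let ?g = "\<lambda>(u, c). served P A adv (one_shot (set_input S)) \<omega> u c"
  have "{p \<in> S. has_updated A p (Suc t) \<omega>} \<subseteq> ?g ` ({..<L} \<times> {..<M})"
  proof safe
    fix p assume "p \<in> S" "has_updated A p (Suc t) \<omega>"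
    then obtain u c where "u < L" "c < M" "?g (u, c) = p"
      using updater_served[OF S _ words coin no lat] by fastforce
    then show "p \<in> ?g ` ({..<L} \<times> {..<M})" by force
  qed
  then have "card {p \<in> S. has_updated A p (Suc t) \<omega>} \<le> card (?g ` ({..<L} \<times> {..<M}))"
    by (intro card_mono) auto
  also have "\<dots> \<le> card ({..<L} \<times> {..<M})" by (intro card_image_le) auto
  finally show ?thesis by (simp add: mult.commute)
qed

section \<open>A set that returns without an update is invisible to a later read\<close>

text \<open>The cases \<open>S = {p}\<close> and \<open>S = {}\<close> are compared. For
  \<open>0 < u\<close> the two inputs coincide from time \<open>u\<close> on, while the read has to
  return different bits.\<close>

definition set_then_read :: "nat set \<Rightarrow> nat \<Rightarrow> nat \<Rightarrow> user_input" where
  "set_then_read S u q =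
     (\<lambda>v. if v = 0 then set_input S else if v = u then (\<lambda>p. if p = q then Some Read_Op else None)
          else (\<lambda>_. None))"

lemma concat_map_single:
  assumes "distinct xs" "q \<in> set xs" "\<And>x. x \<in> set xs \<Longrightarrow> x \<noteq> q \<Longrightarrow> g x = []"
  shows "concat (map g xs) = g q"
proof -
  obtain ys zs where xs: "xs = ys @ q # zs" using assms(2) by (meson split_list)
  have "concat (map g ys) = []" "concat (map g zs) = []"
    using assms(1,3) by (auto simp: xs)
  then show ?thesis by (simp add: xs del: concat_eq_Nil_conv)
qed

text \<open>With a single invoking process there is no order to choose. This takes the power from an
  adaptive adversary, who sees different histories in the two compared executions.\<close>

lemma new_updates_single:
  assumes "q \<in> {1..P}" "\<And>p. p \<noteq> q \<Longrightarrow> ins p = None"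
  shows "new_updates P prio ins c = new_updates P prio' ins c"
proof -
  have "new_updates P pr ins c =
      (case ins q of Some (Update c' f k) \<Rightarrow> if c' = c then [(q, f)] else [] | _ \<Rightarrow> [])" for pr
    unfolding new_updates_def by (rule concat_map_single) (use assms in auto)
  then show ?thesis by simp
qed

text \<open>Only \<open>q\<close> is inside an operation, and the other differences are confined to the local memory
  that \<open>p\<close> keeps while idle.\<close>
definition agree_off ::
  "nat \<Rightarrow> nat \<Rightarrow> ('s, 'w) config \<Rightarrow> ('s, 'w) config \<Rightarrow> bool" where
  "agree_off p q C D \<longleftrightarrow>
     mem C = mem D \<and> queue C = queue D \<and> (\<forall>p'. p' \<noteq> p \<longrightarrow> status C p' = status D p') \<and>
     (\<forall>p'. p' \<noteq> q \<longrightarrow> is_idle (status C p') \<and> is_idle (status D p'))"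

lemma agree_off_invoked:
  assumes "agree_off p q C D" "p \<noteq> q" "\<And>p'. p' \<noteq> q \<Longrightarrow> i p' = None"
  shows "invoked P A i r C = invoked P A i r D"
    and "p' \<noteq> q \<Longrightarrow> invoked P A i r D p' = None"
proof -
  have none: "invoked P A i r C p' = None" "invoked P A i r D p' = None" if "p' \<noteq> q" for p'
    using assms that by (auto simp: invoked_def status_inv_def agree_off_def is_idle_def split: status.splits)
  moreover have "invoked P A i r C q = invoked P A i r D q"
    using assms by (auto simp: invoked_def status_inv_def agree_off_def)
  ultimately show "invoked P A i r C = invoked P A i r D"
    by (metis ext)
  show "p' \<noteq> q \<Longrightarrow> invoked P A i r D p' = None" by (rule none)
qed

text \<open>The priorities differ on the two sides because they come from different histories; by
  \<open>new_updates_single\<close> they have no effect.\<close>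

lemma agree_off_timestep:
  assumes agree: "agree_off p q C D" and "p \<noteq> q" and i: "\<And>p'. p' \<noteq> q \<Longrightarrow> i p' = None"
    and q: "q \<in> {1..P}"
  shows "agree_off p q (timestep P A prio i r C) (timestep P A prio' i r D)"
proof -
  have inv: "invoked P A i r C = invoked P A i r D" "p' \<noteq> q \<Longrightarrow> invoked P A i r D p' = None" for p'
    using agree_off_invoked[of p q C D i] agree \<open>p \<noteq> q\<close> i by blast+
  have new: "new_updates P (prio (invoked P A i r D) c) (invoked P A i r D) c =
      new_updates P (prio' (invoked P A i r D) c) (invoked P A i r D) c" for c
    by (rule new_updates_single[OF q]) (rule inv(2))
  have sti: "status_inv A i E p' = status E p'" if "p' \<noteq> q" for E :: "('a, 'b) config" and p'
    using i[OF that] by (simp add: status_inv_def split: status.splits)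
  have stq: "status_inv A i C q = status_inv A i D q"
    using agree \<open>p \<noteq> q\<close> by (simp add: status_inv_def agree_off_def)
  have eq: "mem C = mem D" "queue C = queue D"
    using agree by (simp_all add: agree_off_def)
  have "status (timestep P A prio i r C) p' = status (timestep P A prio' i r D) p'" if "p' \<noteq> p" for p'
  proof (cases "p' = q")
    case True
    then show ?thesis
      unfolding timestep_def Let_def inv(1) new eq by (simp add: True) (simp only: stq)
  next
    case False
    then show ?thesis
      using agree that unfolding timestep_def Let_def inv(1) new eq
      by (simp add: inv(2) agree_off_def sti)
  qed
  moreover have "is_idle (status (timestep P A prio i r C) p')"
    "is_idle (status (timestep P A prio' i r D) p')" if "p' \<noteq> q" for p'
    using agree that unfolding timestep_def Let_def
    by (auto simp: inv agree_off_def sti is_idle_def split: status.splits)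
  moreover have "mem (timestep P A prio i r C) = mem (timestep P A prio' i r D)"
    "queue (timestep P A prio i r C) = queue (timestep P A prio' i r D)"
    unfolding timestep_def Let_def inv(1) new eq by simp_all
  ultimately show ?thesis unfolding agree_off_def by blast
qed

text \<open>Before \<open>u\<close> only \<open>p\<close> can be inside an operation. Being idle at
  \<open>u\<close> in its solo run, it has not updated, so the execution is quiet and
  \<open>p\<close> has returned when the read is invoked. From \<open>u\<close> on,
  \<open>later\<close> leaves only \<open>q\<close>.\<close>

lemma sequential_set_then_read:
  assumes p: "p \<in> {1..P}" and q: "q \<in> {1..P}" and "p \<noteq> q" and S: "S \<subseteq> {p}" and u: "0 < u"
    and idle: "is_idle (solo A p (\<lambda>v. \<omega> (p, v)) u)"
    and later: "\<And>v p'. u \<le> v \<Longrightarrow> p' \<noteq> q \<Longrightarrow>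
      is_idle (status (config_at P A adv (set_then_read S u q) \<omega> v) p')"
  shows "sequential_execution P A adv (set_then_read S u q) \<omega>"
proof -
  let ?I = "set_then_read S u q"
  have S': "S \<subseteq> {1..P}" using S p by auto
  have conf: "config_at P A adv ?I \<omega> v = quiet_config A S \<omega> v" if "v \<le> u" for v
  proof (rule config_at_quiet[OF S'])
    show "\<not> has_updated A p' v \<omega>" if "p' \<in> S" for p'
      using S idle that \<open>v \<le> u\<close> has_updated_mono[of v u A p' \<omega>]
      by (auto simp: has_updated_def is_waiting_def is_idle_def)
  qed (use that in \<open>auto simp: set_then_read_def\<close>)
  have one: "p1 = p2"
    if "\<not> is_idle (status_inv A (?I v) (config_at P A adv ?I \<omega> v) p1)"
       "\<not> is_idle (status_inv A (?I v) (config_at P A adv ?I \<omega> v) p2)" for v p1 p2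
  proof (cases "v < u")
    case True
    then have "status_inv A (?I v) (config_at P A adv ?I \<omega> v) p' =
        (if p' \<in> S then solo A p' (\<lambda>u. \<omega> (p', u)) v else Idle (init_local A p'))" for p'
      unfolding conf[OF less_imp_le[OF True]]
      by (intro status_inv_quiet) (auto simp: set_then_read_def)
    with that have "p1 \<in> S" "p2 \<in> S" by (auto simp: is_idle_def split: if_splits)
    with S show ?thesis by auto
  next
    case False
    then have "is_idle (status_inv A (?I v) (config_at P A adv ?I \<omega> v) p')" if "p' \<noteq> q" for p'
      using later[of v p'] that u
      by (auto simp: status_inv_def is_idle_def set_then_read_def split: status.splits)
    with that show ?thesis by metis
  qed
  have "is_idle (status (config_at P A adv ?I \<omega> v) p')" if "?I v p' \<noteq> None" for v p'
  proof -
    have "v = 0 \<or> v = u \<and> p' = q"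
      using that by (auto simp: set_then_read_def split: if_splits)
    moreover have "q \<notin> S" using S \<open>p \<noteq> q\<close> by auto
    ultimately show ?thesis
      by (auto simp: conf quiet_config_def init_config_def is_idle_def)
  qed
  with one show ?thesis unfolding sequential_execution_def Let_def by blast
qed

text \<open>If the set could return without an update, a later read by another process could not tell the
  execution from one without a set.\<close>
lemma solo_set_updates:
  assumes p: "p \<in> {1..P}" and q: "q \<in> {1..P}" and "p \<noteq> q"
    and corr: "\<And>S. S = {p} \<or> S = {} \<Longrightarrow> sequential_execution P A adv (set_then_read S u q) \<omega> \<Longrightarrow>
      correct_execution P A adv (set_then_read S u q) \<omega>"
  shows "\<not> is_idle (solo A p (\<lambda>v. \<omega> (p, v)) u)"
proof
  assume idle: "is_idle (solo A p (\<lambda>v. \<omega> (p, v)) u)"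
  then have u: "0 < u" by (cases u) (auto simp: is_idle_def)
  let ?I = "\<lambda>S. set_then_read S u q"
  let ?C = "\<lambda>S. config_at P A adv (?I S) \<omega>"
  have conf: "?C S u = quiet_config A S \<omega> u" if "S \<subseteq> {p}" for S
  proof (rule config_at_quiet)
    show "\<not> has_updated A p' u \<omega>" if "p' \<in> S" for p'
      using \<open>S \<subseteq> {p}\<close> that idle by (auto simp: has_updated_def is_waiting_def is_idle_def)
  qed (use that p in \<open>auto simp: set_then_read_def\<close>)
  have I: "?I {p} v = ?I {} v" "p' \<noteq> q \<Longrightarrow> ?I {} v p' = None" if "u \<le> v" for v p'
    using that u by (auto simp: set_then_read_def)
  have agree: "agree_off p q (?C {p} v) (?C {} v)" if "u \<le> v" for v
    using that
  proof (induction v rule: dec_induct)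
    case base
    show ?case
      using idle \<open>p \<noteq> q\<close> by (auto simp: conf agree_off_def quiet_config_def is_idle_def)
  next
    case (step v)
    then show ?case
      unfolding config_at_Suc I(1)[OF step(1)]
      by (intro agree_off_timestep \<open>p \<noteq> q\<close> q I(2))
  qed
  have seq: "sequential_execution P A adv (?I S) \<omega>" if "S = {p} \<or> S = {}" for S
    using agree that
    by (intro sequential_set_then_read[OF p q \<open>p \<noteq> q\<close> _ u idle]) (auto simp: agree_off_def)
  have resp: "responds P A adv (?I {p}) \<omega> v q b \<longleftrightarrow> responds P A adv (?I {}) \<omega> v q b" if "u \<le> v" for v b
    unfolding responds_def I(1)[OF that]
    by (subst agree_off_invoked(1)[OF agree[OF that] \<open>p \<noteq> q\<close>]) (use I(2) that in auto)
  have read: "?I S u q = Some Read_Op" for S using u by (simp add: set_then_read_def)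
  have none: "?I {} v q' \<noteq> Some Set_Op" for v q' by (auto simp: set_then_read_def set_input_def)
  have "?I {p} 0 p = Some Set_Op" by (simp add: set_then_read_def set_input_def)
  then have set: "\<exists>v<u. \<exists>q\<in>{1..P}. ?I {p} v q = Some Set_Op" using u p by blast
  have "correct_execution P A adv (?I {p}) \<omega>" using corr seq by blast
  then obtain t1 where t1: "u \<le> t1" "responds P A adv (?I {p}) \<omega> t1 q True"
      "\<forall>v\<in>{u..<t1}. \<forall>b. \<not> responds P A adv (?I {p}) \<omega> v q b"
    using q read set unfolding correct_execution_def by metis
  have "correct_execution P A adv (?I {}) \<omega>" using corr seq by blast
  then obtain t2 where t2: "u \<le> t2" "responds P A adv (?I {}) \<omega> t2 q False"
      "\<forall>v\<in>{u..<t2}. \<forall>b. \<not> responds P A adv (?I {}) \<omega> v q b"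
    using q read none unfolding correct_execution_def by metis
  \<comment> \<open>The responses at \<open>q\<close> agree from \<open>u\<close> on, so the first
    ones occur in the same timestep, where one instruction would return both \<open>True\<close> and
    \<open>False\<close>.\<close>
  have "t1 = t2"
    using t1 t2 resp by (metis atLeastLessThan_iff linorder_neqE_nat)
  then show False using t1 t2 resp by (auto simp: responds_def)
qed

lemma solo_latency_ge:
  assumes p: "p \<in> {1..P}"
    and upd: "\<And>u. \<not> is_idle (solo A p (\<lambda>v. \<omega> (p, v)) u)"
    and no: "\<not> has_updated A p t \<omega>"
  shows "enat (Suc t) \<le> latency P A adv (set_input {p}) \<omega> p"
proof (rule latency_ge)
  fix u b assume "u < t"
  show "\<not> responds P A adv (one_shot (set_input {p})) \<omega> u p b"
  proof
    assume "responds P A adv (one_shot (set_input {p})) \<omega> u p b"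
    then have "is_idle (solo A p (\<lambda>v. \<omega> (p, v)) (Suc u))"
      by (rule responds_quiet[where S = "{p}", rotated 4])
        (use p no \<open>u < t\<close> has_updated_mono[of u t] in \<open>auto simp: one_shot_set_input\<close>)
    with upd show False by blast
  qed
qed

section \<open>Measurability and independence of the coins\<close>

abbreviation coins :: "('s, 'w, 'r) implementation \<Rightarrow> nat \<times> nat \<Rightarrow> 'r measure" where
  "coins A \<equiv> (\<lambda>(p, t). measure_pmf (coin A p))"

lemma prob_space_coin_space: "prob_space (coin_space P A)"
  unfolding coin_space_def by (rule prob_space_PiM) (auto simp: prob_space_measure_pmf)

text \<open>The possibly uncountable type of statuses carries the discrete sigma-algebra;
  measurability of a step comes from splitting over the countably many values of the coin. The index
  set \<open>J\<close> is either that of the whole coin space or the block of one process.\<close>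

lemma measurable_solo:
  fixes A :: "('s, 'w, 'r::countable) implementation"
  assumes "{p} \<times> UNIV \<subseteq> J"
  shows "(\<lambda>\<omega>. solo A p (\<lambda>u. \<omega> (p, u)) t) \<in> PiM J (coins A) \<rightarrow>\<^sub>M count_space UNIV"
proof (induction t)
  case 0
  show ?case by simp
next
  case (Suc t)
  have "(\<lambda>\<omega>. \<omega> (p, t)) \<in> PiM J (coins A) \<rightarrow>\<^sub>M coins A (p, t)"
    using assms by (intro measurable_component_singleton) auto
  then have coord: "(\<lambda>\<omega>. \<omega> (p, t)) \<in> PiM J (coins A) \<rightarrow>\<^sub>M count_space UNIV"
    by (simp add: measurable_def)
  have "(\<lambda>\<omega>. solo_step A p (\<omega> (p, t)) (solo A p (\<lambda>u. \<omega> (p, u)) t))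
      \<in> PiM J (coins A) \<rightarrow>\<^sub>M count_space UNIV"
    by (rule measurable_compose_countable[OF _ coord]) (rule measurable_compose[OF Suc], simp)
  then show ?case by simp
qed

lemma measurable_has_updated:
  fixes A :: "('s, 'w, 'r::countable) implementation"
  assumes "{p} \<times> UNIV \<subseteq> J"
  shows "(\<lambda>\<omega>. has_updated A p t \<omega>) \<in> PiM J (coins A) \<rightarrow>\<^sub>M count_space UNIV"
  unfolding has_updated_def by (rule measurable_compose[OF measurable_solo[OF assms]]) simp

lemma measurable_has_updated_coin_space [measurable]:
  fixes A :: "('s, 'w, 'r::countable) implementation"
  assumes "p \<in> {1..P}"
  shows "(\<lambda>\<omega>. has_updated A p t \<omega>) \<in> coin_space P A \<rightarrow>\<^sub>M count_space UNIV"
  unfolding coin_space_def by (rule measurable_has_updated) (use assms in auto)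

text \<open>The joint law of the coordinates is \<open>PiM I N\<close> itself and the marginals are
  the \<open>N i\<close>, so the joint law is the product of the marginals.\<close>

lemma indep_vars_PiM_coordinates:
  assumes "I \<noteq> {}" "\<And>i. i \<in> I \<Longrightarrow> prob_space (N i)"
  shows "prob_space.indep_vars (PiM I N) N (\<lambda>i \<omega>. \<omega> i) I"
proof -
  interpret prob_space "PiM I N" by (rule prob_space_PiM) (rule assms(2))
  have "distr (PiM I N) (PiM I N) (\<lambda>\<omega>. \<lambda>i\<in>I. \<omega> i) = distr (PiM I N) (PiM I N) (\<lambda>\<omega>. \<omega>)"
    by (intro distr_cong) (auto simp: space_PiM)
  also have "\<dots> = PiM I N" by simp
  also have "\<dots> = PiM I (\<lambda>i. distr (PiM I N) (N i) (\<lambda>\<omega>. \<omega> i))"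
    by (intro PiM_cong) (simp_all add: distr_PiM_component assms(2))
  finally show ?thesis
    by (subst indep_vars_iff_distr_eq_PiM'[OF \<open>I \<noteq> {}\<close>]) auto
qed

text \<open>Precomposing with \<open>restrict\<close> expresses that an event depends only on the
  coins of one process; different processes own disjoint blocks of independent coordinates.\<close>

lemma indep_processes:
  assumes "p \<in> {1..P}" "q \<in> {1..P}" "p \<noteq> q"
    and Q1: "Q1 \<in> PiM ({p} \<times> UNIV) (coins A) \<rightarrow>\<^sub>M count_space UNIV"
    and Q2: "Q2 \<in> PiM ({q} \<times> UNIV) (coins A) \<rightarrow>\<^sub>M count_space UNIV"
  shows "measure (coin_space P A)
      {\<omega> \<in> space (coin_space P A). Q1 (restrict \<omega> ({p} \<times> UNIV)) \<and> Q2 (restrict \<omega> ({q} \<times> UNIV))} =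
    measure (coin_space P A) {\<omega> \<in> space (coin_space P A). Q1 (restrict \<omega> ({p} \<times> UNIV))} *
    measure (coin_space P A) {\<omega> \<in> space (coin_space P A). Q2 (restrict \<omega> ({q} \<times> UNIV))}"
proof -
  interpret prob_space "coin_space P A" by (rule prob_space_coin_space)
  have "indep_vars (coins A) (\<lambda>i \<omega>. \<omega> i) ({1..P} \<times> UNIV)"
    unfolding coin_space_def
    by (rule indep_vars_PiM_coordinates) (use assms in \<open>auto simp: prob_space_measure_pmf\<close>)
  then have "indep_var (PiM ({p} \<times> UNIV) (coins A)) (\<lambda>\<omega>. restrict (\<lambda>i. \<omega> i) ({p} \<times> UNIV))
      (PiM ({q} \<times> UNIV) (coins A)) (\<lambda>\<omega>. restrict (\<lambda>i. \<omega> i) ({q} \<times> UNIV))"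
    by (rule indep_var_restrict) (use assms in auto)
  from indep_var_compose[OF this Q1 Q2]
  have "prob ((\<lambda>x. ((Q1 \<circ> (\<lambda>\<omega>. restrict \<omega> ({p} \<times> UNIV))) x, (Q2 \<circ> (\<lambda>\<omega>. restrict \<omega> ({q} \<times> UNIV))) x))
        -` ({True} \<times> {True}) \<inter> space (coin_space P A)) =
      prob ((Q1 \<circ> (\<lambda>\<omega>. restrict \<omega> ({p} \<times> UNIV))) -` {True} \<inter> space (coin_space P A)) *
      prob ((Q2 \<circ> (\<lambda>\<omega>. restrict \<omega> ({q} \<times> UNIV))) -` {True} \<inter> space (coin_space P A))"
    by (rule indep_varD) auto
  then show ?thesis
    by (simp add: vimage_def Int_def conj_commute)
qed

section \<open>Growth of the update probabilities\<close>

text \<open>This is the quantity \<open>F t p\<close> of the overview. No adversary occurs in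
  it.\<close>

definition update_prob :: "nat \<Rightarrow> ('s, 'w, 'r) implementation \<Rightarrow> nat \<Rightarrow> nat \<Rightarrow> real" where
  "update_prob P A t p = measure (coin_space P A) {\<omega> \<in> space (coin_space P A). has_updated A p t \<omega>}"

lemma update_prob_0 [simp]: "update_prob P A 0 p = 0"
  by (simp add: update_prob_def)

lemma update_prob_Suc_indep:
  fixes A :: "('s, 'w, 'r::countable) implementation"
  assumes p: "p \<in> {1..P}" and q: "q \<in> {1..P}" and "p \<noteq> q"
  shows "measure (coin_space P A) {\<omega> \<in> space (coin_space P A).
      (has_updated A p (Suc t) \<omega> \<and> \<not> has_updated A p t \<omega>) \<and> has_updated A q t \<omega>} =
    measure (coin_space P A) {\<omega> \<in> space (coin_space P A).
      has_updated A p (Suc t) \<omega> \<and> \<not> has_updated A p t \<omega>} * update_prob P A t q"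
proof -
  have res: "has_updated A p' u (restrict \<omega> ({p'} \<times> UNIV)) = has_updated A p' u \<omega>" for p' u \<omega>
    by (simp add: has_updated_def)
  note [measurable] = measurable_has_updated[OF order_refl]
  have "(\<lambda>\<omega>. has_updated A p (Suc t) \<omega> \<and> \<not> has_updated A p t \<omega>)
      \<in> PiM ({p} \<times> UNIV) (coins A) \<rightarrow>\<^sub>M count_space UNIV"
    by measurable
  from indep_processes[OF p q \<open>p \<noteq> q\<close> this measurable_has_updated[OF order_refl, where t = t]]
  show ?thesis by (simp add: res update_prob_def)
qed

text \<open>\<open>uses_words\<close> bounds the cells only for coins in the support, so the
  confinement to \<open>M\<close> cells is an almost sure statement.\<close>

lemma AE_coins_in_support:
  "AE \<omega> in coin_space P A. \<forall>p\<in>{1..P}. \<omega> (p, t) \<in> set_pmf (coin A p)"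
proof (intro AE_finite_allI)
  fix p assume "p \<in> {1..P}"
  then show "AE \<omega> in coin_space P A. \<omega> (p, t) \<in> set_pmf (coin A p)"
    unfolding coin_space_def
    by (intro AE_PiM_component[where i = "(p, t)" and P = "\<lambda>x. x \<in> set_pmf (coin A p)"])
      (auto simp: prob_space_measure_pmf AE_measure_pmf)
qed simp

text \<open>A first update of \<open>p\<close> in timestep \<open>t\<close> is independent of the coins of the others, which with
  probability at least \<open>1 / 2\<close> lead to no earlier update. So the expected number of updaters in
  timestep \<open>t\<close> is at least half of the increase of the sum.\<close>
lemma sum_update_prob_Suc:
  fixes A :: "('s, 'w, 'r::countable) implementation"
  assumes S: "S \<subseteq> {1..P}" and P: "2 \<le> P" and words: "uses_words P M A"
    and whp: "sets_complete_whp \<kappa> P Adv L A" and adv: "adv \<in> Adv" and \<kappa>: "2 \<le> \<kappa>"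
    and half: "(\<Sum>p\<in>S. update_prob P A t p) \<le> 1 / 2"
  shows "(\<Sum>p\<in>S. update_prob P A (Suc t) p) \<le> 2 * (real (M * L) + 1) + 1 / 2"
proof -
  interpret prob_space "coin_space P A" by (rule prob_space_coin_space)
  let ?\<Omega> = "space (coin_space P A)"
  have fin: "finite S" using S finite_subset by blast
  have meas [measurable]: "(\<lambda>\<omega>. has_updated A p u \<omega>) \<in> coin_space P A \<rightarrow>\<^sub>M count_space UNIV"
    if "p \<in> S" for p u
    using S that by (intro measurable_has_updated_coin_space) auto
  define D where "D p = {\<omega> \<in> ?\<Omega>. has_updated A p (Suc t) \<omega> \<and> \<not> has_updated A p t \<omega>}" for p
  \<comment> \<open>\<open>D p\<close> speaks of the solo run of \<open>p\<close> only. On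
    \<open>E p\<close> the concurrent execution is moreover still quiet at time \<open>t\<close>, so
    that \<open>card_updaters_le\<close> applies outside \<open>Bad\<close>.\<close>
  define E where "E p = {\<omega> \<in> ?\<Omega>. has_updated A p (Suc t) \<omega> \<and> (\<forall>q\<in>S. \<not> has_updated A q t \<omega>)}" for p
  define W where "W p = {\<omega> \<in> ?\<Omega>. has_updated A p t \<omega>}" for p
  define G where "G p = {\<omega> \<in> ?\<Omega>. latency P A adv (set_input S) \<omega> p \<le> enat L}" for p
  define Bad where "Bad = (\<Union>p\<in>S. ?\<Omega> - G p)"
  have pow: "real P ^ 2 \<le> real P powr \<kappa>"
    using powr_mono[of 2 \<kappa> "real P"] \<kappa> P by (simp add: powr_numeral)
  have "1 < real P ^ 2" using P by (simp add: one_less_power)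
  with pow have "1 < real P powr \<kappa>" by linarith
  then have pos: "1 / real P powr \<kappa> < 1" by (simp add: divide_less_eq)
  have G: "1 - 1 / real P powr \<kappa> \<le> prob (G p)" if "p \<in> S" for p
    using whp adv S that unfolding sets_complete_whp_def G_def by (auto simp: set_input_def)
  \<comment> \<open>Measurability under an arbitrary adversary comes from the bound itself:
    \<open>measure\<close> is 0 on sets that are not measurable, but \<open>G p\<close> has positive
    measure.\<close>
  have G_sets: "G p \<in> events" if "p \<in> S" for p
    using G[OF that] pos measure_notin_sets[of "G p" "coin_space P A"] by force
  have Bad_sets: "Bad \<in> events" unfolding Bad_def by (rule sets.finite_UN) (use G_sets fin in auto)
  have D_sets: "D p \<in> events" and E_sets: "E p \<in> events" and W_sets: "W p \<in> events" if "p \<in> S" for p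
    using that fin unfolding D_def E_def W_def by measurable
  \<comment> \<open>A union bound over at most \<open>P\<close> sets gives
    \<open>P / P powr \<kappa>\<close>. One more factor \<open>P\<close> is needed for the trivial
    count on \<open>Bad\<close> below, which is where \<open>2 \<le> \<kappa>\<close> comes
    from.\<close>
  have "prob Bad \<le> (\<Sum>p\<in>S. prob (?\<Omega> - G p))"
    unfolding Bad_def by (rule finite_measure_subadditive_finite) (use fin G_sets in auto)
  also have "\<dots> \<le> (\<Sum>p\<in>S. 1 / real P powr \<kappa>)"
    using G by (intro sum_mono) (simp add: prob_compl G_sets algebra_simps)
  also have "\<dots> \<le> real P * (1 / real P powr \<kappa>)"
    using card_mono[OF _ S] by (auto intro!: divide_right_mono)
  finally have "real P * prob Bad \<le> real P * (real P * (1 / real P powr \<kappa>))"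
    by (rule mult_left_mono) simp
  also have "\<dots> \<le> 1"
    using pow P by (simp add: power2_eq_square field_simps)
  finally have Bad: "real P * prob Bad \<le> 1" .
  have half_E: "prob (D p) \<le> 2 * prob (E p)" if p: "p \<in> S" for p
  proof -
    have "D p \<subseteq> E p \<union> (\<Union>q\<in>S - {p}. D p \<inter> W q)"
      by (auto simp: D_def E_def W_def)
    then have "prob (D p) \<le> prob (E p \<union> (\<Union>q\<in>S - {p}. D p \<inter> W q))"
      by (rule finite_measure_mono) (use p fin E_sets D_sets W_sets in auto)
    also have "\<dots> \<le> prob (E p) + prob (\<Union>q\<in>S - {p}. D p \<inter> W q)"
      by (rule measure_Un_le) (use p fin E_sets D_sets W_sets in auto)
    also have "prob (\<Union>q\<in>S - {p}. D p \<inter> W q) \<le> (\<Sum>q\<in>S - {p}. prob (D p \<inter> W q))"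
      by (rule finite_measure_subadditive_finite) (use p fin D_sets W_sets in auto)
    also have "(\<Sum>q\<in>S - {p}. prob (D p \<inter> W q)) = (\<Sum>q\<in>S - {p}. prob (D p) * update_prob P A t q)"
    proof (rule sum.cong)
      fix q assume q: "q \<in> S - {p}"
      have "D p \<inter> W q = {\<omega> \<in> ?\<Omega>.
          (has_updated A p (Suc t) \<omega> \<and> \<not> has_updated A p t \<omega>) \<and> has_updated A q t \<omega>}"
        by (auto simp: D_def W_def)
      moreover have "p \<in> {1..P}" "q \<in> {1..P}" "p \<noteq> q" using p q S by auto
      ultimately show "prob (D p \<inter> W q) = prob (D p) * update_prob P A t q"
        using update_prob_Suc_indep[where p = p and q = q and P = P and A = A and t = t] by (simp add: D_def)
    qed simp
    also have "\<dots> = prob (D p) * (\<Sum>q\<in>S - {p}. update_prob P A t q)"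
      by (simp add: sum_distrib_left)
    also have "\<dots> \<le> prob (D p) * (\<Sum>q\<in>S. update_prob P A t q)"
      using fin by (intro mult_left_mono sum_mono2) (auto simp: update_prob_def)
    also have "\<dots> \<le> prob (D p) * (1 / 2)"
      by (intro mult_left_mono half) simp
    finally show ?thesis by simp
  qed
  \<comment> \<open>Outside \<open>Bad\<close> at most \<open>M * L\<close> updates are served in
    time; on \<open>Bad\<close> the count is at most \<open>P\<close>, which contributes at most 1
    to the expectation.\<close>
  have bound: "AE \<omega> in coin_space P A. (\<Sum>p\<in>S. indicator (E p) \<omega>) \<le> real (M * L) + real P * indicator Bad \<omega>"
    using AE_coins_in_support[where P = P and A = A and t = t] AE_space
  proof eventually_elim
    case (elim \<omega>)
    have sum: "(\<Sum>p\<in>S. indicator (E p) \<omega>) = real (card {p \<in> S. \<omega> \<in> E p})"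
      using fin by (simp add: indicator_def sum.If_cases Int_def)
    show ?case
    proof (cases "\<omega> \<in> Bad")
      case True
      have "card {p \<in> S. \<omega> \<in> E p} \<le> card {1..P}"
        using S by (intro card_mono) auto
      then have "real (card {p \<in> S. \<omega> \<in> E p}) \<le> real P" by simp
      moreover have "0 \<le> real (M * L)" by (rule of_nat_0_le_iff)
      ultimately show ?thesis unfolding sum indicator_simps(1)[OF True] by linarith
    next
      case False
      have "card {p \<in> S. \<omega> \<in> E p} \<le> M * L"
      proof (cases "\<forall>q\<in>S. \<not> has_updated A q t \<omega>")
        case True
        have "card {p \<in> S. has_updated A p (Suc t) \<omega>} \<le> M * L"
          using False elim True S
          by (intro card_updaters_le[OF S words, where adv = adv]) (auto simp: Bad_def G_def)
        with True elim show ?thesis by (simp add: E_def)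
      next
        case no: False
        then have "{p \<in> S. \<omega> \<in> E p} = {}" by (auto simp: E_def)
        then show ?thesis by (simp only: card.empty zero_le)
      qed
      then show ?thesis unfolding sum using False by (simp flip: of_nat_mult)
    qed
  qed
  have "(\<Sum>p\<in>S. prob (E p)) = (\<integral>\<omega>. (\<Sum>p\<in>S. indicator (E p) \<omega>) \<partial>coin_space P A)"
    using E_sets by (subst Bochner_Integration.integral_sum) (auto simp: integrable_indicator_iff emeasure_eq_measure)
  also have "\<dots> \<le> (\<integral>\<omega>. real (M * L) + real P * indicator Bad \<omega> \<partial>coin_space P A)"
    using E_sets Bad_sets
    by (intro integral_mono_AE bound Bochner_Integration.integrable_sum Bochner_Integration.integrable_add
        integrable_mult_right) (auto simp: integrable_indicator_iff emeasure_eq_measure)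
  also have "\<dots> = real (M * L) + real P * prob Bad"
    using Bad_sets by (subst Bochner_Integration.integral_add)
      (auto simp: integrable_indicator_iff emeasure_eq_measure prob_space)
  finally have sum_E: "(\<Sum>p\<in>S. prob (E p)) \<le> real (M * L) + 1" using Bad by linarith
  have "update_prob P A (Suc t) p \<le> update_prob P A t p + 2 * prob (E p)" if p: "p \<in> S" for p
  proof -
    have "{\<omega> \<in> ?\<Omega>. has_updated A p (Suc t) \<omega>} = W p \<union> D p"
      by (auto simp: W_def D_def intro: has_updated_Suc)
    then have "update_prob P A (Suc t) p \<le> prob (W p) + prob (D p)"
      unfolding update_prob_def using measure_Un_le[of "W p" _ "D p"] W_sets D_sets p by simp
    then show ?thesis using half_E[OF p] by (simp add: W_def update_prob_def)
  qed
  then have "(\<Sum>p\<in>S. update_prob P A (Suc t) p) \<le> (\<Sum>p\<in>S. update_prob P A t p + 2 * prob (E p))"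
    by (rule sum_mono)
  also have "\<dots> = (\<Sum>p\<in>S. update_prob P A t p) + 2 * (\<Sum>p\<in>S. prob (E p))"
    by (simp add: sum.distrib sum_distrib_left)
  also have "\<dots> \<le> 1 / 2 + 2 * (real (M * L) + 1)"
    by (intro add_mono half mult_left_mono sum_E) simp
  finally show ?thesis by (simp only: add.commute)
qed

text \<open>The average over \<open>T\<close> is at most that over \<open>S\<close>, with
  denominators cleared. Starting from \<open>T = S\<close>, a largest element is discarded again and
  again; it is at least the average, so the average does not grow.\<close>

lemma subset_sum_le_average:
  fixes f :: "'a \<Rightarrow> real"
  assumes "finite S" "m \<le> card S"
  shows "\<exists>T\<subseteq>S. card T = m \<and> real (card S) * sum f T \<le> real m * sum f S"
  using assms(2)
proof (induction m rule: inc_induct)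
  case base
  show ?case by blast
next
  case (step m)
  then obtain T where T: "T \<subseteq> S" "card T = Suc m" "real (card S) * sum f T \<le> real (Suc m) * sum f S"
    by blast
  have finT: "finite T" using T(1) assms(1) finite_subset by blast
  have "T \<noteq> {}" using T(2) by auto
  then have "Max (f ` T) \<in> f ` T" using finT by (intro Max_in) auto
  then obtain x where x: "x \<in> T" "f x = Max (f ` T)" by auto
  have "sum f T \<le> (\<Sum>y\<in>T. f x)"
    using finT x by (intro sum_mono) simp
  then have le: "sum f T \<le> real (Suc m) * f x" by (simp add: T(2))
  have rem: "sum f (T - {x}) = sum f T - f x"
    using finT x by (simp add: sum_diff1)
  have "real (Suc m) * (real (card S) * sum f (T - {x})) =
      real (card S) * (real (Suc m) * sum f T - real (Suc m) * f x)"
    unfolding rem by (simp add: algebra_simps)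
  also have "\<dots> \<le> real (card S) * (real (Suc m) * sum f T - sum f T)"
    using le by (intro mult_left_mono) auto
  also have "\<dots> = real m * (real (card S) * sum f T)" by (simp add: algebra_simps)
  also have "\<dots> \<le> real m * (real (Suc m) * sum f S)" by (intro mult_left_mono T(3)) simp
  finally have "real (Suc m) * (real (card S) * sum f (T - {x})) \<le> real (Suc m) * (real m * sum f S)"
    by (simp add: algebra_simps)
  then have "real (card S) * sum f (T - {x}) \<le> real m * sum f S"
    by (rule mult_left_le_imp_le) simp
  moreover have "T - {x} \<subseteq> S" "card (T - {x}) = m"
    using T x finT by (auto simp: card_Diff_singleton)
  ultimately show ?case by blast
qed

text \<open>Each round selects the share \<open>1 / (8 * (M * L))\<close> of the processes that are
  least likely to have updated; nested \<open>div\<close> accounts for the rounding.\<close>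

lemma unlikely_updaters:
  fixes A :: "('s, 'w, 'r::countable) implementation"
  assumes P: "2 \<le> P" and words: "uses_words P M A"
    and whp: "sets_complete_whp \<kappa> P Adv L A" and adv: "adv \<in> Adv" and \<kappa>: "2 \<le> \<kappa>"
    and slots: "2 \<le> M * L"
  shows "\<exists>S\<subseteq>{1..P}. card S = P div (8 * (M * L)) ^ t \<and> (\<Sum>p\<in>S. update_prob P A t p) \<le> 1 / 2"
proof (induction t)
  case 0
  show ?case by (intro exI[of _ "{1..P}"]) simp
next
  case (Suc t)
  then obtain S where S: "S \<subseteq> {1..P}" "card S = P div (8 * (M * L)) ^ t"
    and half: "(\<Sum>p\<in>S. update_prob P A t p) \<le> 1 / 2"
    by blast
  let ?F = "update_prob P A (Suc t)"
  define m where "m = card S div (8 * (M * L))"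
  have m: "m = P div (8 * (M * L)) ^ Suc t"
    by (simp add: m_def S(2) div_mult2_eq[symmetric] mult.commute)
  have "finite S" using S(1) finite_subset by blast
  moreover have "m \<le> card S" by (simp add: m_def)
  ultimately obtain T where T: "T \<subseteq> S" "card T = m" "real (card S) * sum ?F T \<le> real m * sum ?F S"
    using subset_sum_le_average by metis
  have "sum ?F T \<le> 1 / 2"
  proof (cases "m = 0")
    \<comment> \<open>Rounding has emptied the set; the claim is then trivial.\<close>
    case True
    with T(1,2) \<open>finite S\<close> have "T = {}" by (simp add: finite_subset)
    then show ?thesis by simp
  next
    case False
    have "real m * real (8 * (M * L)) \<le> real (card S)"
      unfolding m_def of_nat_mult[symmetric] of_nat_le_iff by (rule div_times_less_eq_dividend)
    moreover have "0 \<le> sum ?F T" by (simp add: sum_nonneg update_prob_def)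
    ultimately have "real m * real (8 * (M * L)) * sum ?F T \<le> real (card S) * sum ?F T"
      by (rule mult_right_mono)
    also have "\<dots> \<le> real m * sum ?F S" by (rule T(3))
    also have "\<dots> \<le> real m * (2 * (real (M * L) + 1) + 1 / 2)"
      by (intro mult_left_mono sum_update_prob_Suc[OF S(1) P words whp adv \<kappa> half]) simp
    finally have "real m * (real (8 * (M * L)) * sum ?F T) \<le> real m * (2 * (real (M * L) + 1) + 1 / 2)"
      by (simp add: mult.assoc)
    then have "real (8 * (M * L)) * sum ?F T \<le> 2 * (real (M * L) + 1) + 1 / 2"
      using False by simp
    \<comment> \<open>For \<open>x = M * L \<ge> 2\<close> one has
      \<open>2 * (x + 1) + 1 / 2 \<le> 4 * x\<close>, which explains the constant 8.\<close>
    also have "\<dots> \<le> real (8 * (M * L)) * (1 / 2)"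
      using of_nat_mono[OF slots, where 'a = real] by (simp add: mult.commute)
    finally show ?thesis
    proof (rule mult_left_le_imp_le)
      show "0 < real (8 * (M * L))" using slots unfolding of_nat_0_less_iff by linarith
    qed
  qed
  with T S(1) m show ?case by blast
qed

section \<open>Expected latency of a single set\<close>

text \<open>Correctness holds almost surely for each input separately. The argument needs only two
  inputs for each of the countably many times \<open>u\<close>, so the null sets can be united. The
  reader \<open>q\<close> exists because \<open>2 \<le> P\<close>.\<close>

lemma AE_solo_updates:
  assumes P: "2 \<le> P" and p: "p \<in> {1..P}" and corr: "sequentially_correct P Adv A" and adv: "adv \<in> Adv"
  shows "AE \<omega> in coin_space P A. \<forall>u. \<not> is_idle (solo A p (\<lambda>v. \<omega> (p, v)) u)"
proof -
  obtain q where q: "q \<in> {1..P}" "p \<noteq> q"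
    using P by (metis One_nat_def Suc_1 Suc_le_mono atLeastAtMost_iff le_SucI n_not_Suc_n order_refl zero_le)
  have "AE \<omega> in coin_space P A. sequential_execution P A adv I \<omega> \<longrightarrow> correct_execution P A adv I \<omega>" for I
    using corr adv by (simp add: sequentially_correct_def)
  then have "AE \<omega> in coin_space P A. \<forall>u. \<forall>S\<in>{{p}, {}}.
      sequential_execution P A adv (set_then_read S u q) \<omega> \<longrightarrow>
      correct_execution P A adv (set_then_read S u q) \<omega>"
    by (subst AE_all_countable, intro allI AE_finite_allI) auto
  then show ?thesis
  proof eventually_elim
    case (elim \<omega>)
    show ?case
      by (intro allI solo_set_updates[OF p q]) (use elim in auto)
  qed
qed

lemma expected_latency_solo_ge:
  fixes A :: "('s, 'w, 'r::countable) implementation"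
  assumes P: "2 \<le> P" and p: "p \<in> {1..P}" and corr: "sequentially_correct P Adv A" and adv: "adv \<in> Adv"
    and half: "update_prob P A t p \<le> 1 / 2"
  shows "ennreal (real (Suc t) / 2) \<le> expected_latency P A adv (set_input {p}) p"
proof -
  interpret prob_space "coin_space P A" by (rule prob_space_coin_space)
  note [measurable] = measurable_has_updated_coin_space[OF p]
  define N where "N = {\<omega> \<in> space (coin_space P A). \<not> has_updated A p t \<omega>}"
  have N: "N \<in> events" unfolding N_def by measurable
  have "N = space (coin_space P A) - {\<omega> \<in> space (coin_space P A). has_updated A p t \<omega>}"
    by (auto simp: N_def)
  then have "prob N = 1 - update_prob P A t p"
    unfolding update_prob_def by (simp add: prob_compl)
  with half have "1 / 2 \<le> prob N" by simp
  then have "real (Suc t) * (1 / 2) \<le> real (Suc t) * prob N" by (intro mult_left_mono) auto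
  then have "ennreal (real (Suc t) / 2) \<le> ennreal (real (Suc t) * prob N)"
    by (intro ennreal_leI) simp
  also have "\<dots> = of_nat (Suc t) * emeasure (coin_space P A) N"
    by (simp add: ennreal_mult emeasure_eq_measure ennreal_of_nat_eq_real_of_nat)
  also have "\<dots> = (\<integral>\<^sup>+\<omega>. of_nat (Suc t) * indicator N \<omega> \<partial>coin_space P A)"
    using N by (simp add: nn_integral_cmult_indicator)
  also have "\<dots> \<le> expected_latency P A adv (set_input {p}) p"
    unfolding expected_latency_def
  \<comment> \<open>Monotonicity of the nonnegative integral holds for arbitrary functions, so
    measurability of the latency is not at issue.\<close>
  proof (rule nn_integral_mono_AE)
    show "AE \<omega> in coin_space P A. of_nat (Suc t) * indicator N \<omega> \<le>
        ennreal_of_enat (latency P A adv (set_input {p}) \<omega> p)"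
      using AE_solo_updates[OF P p corr adv]
    proof eventually_elim
      case (elim \<omega>)
      have "ennreal_of_enat (enat (Suc t)) \<le> ennreal_of_enat (latency P A adv (set_input {p}) \<omega> p)"
        if "\<omega> \<in> N"
        unfolding ennreal_of_enat_le_iff
        by (rule solo_latency_ge[OF p]) (use elim that in \<open>auto simp: N_def\<close>)
      then show ?case by (simp add: indicator_def)
    qed
  qed
  finally show ?thesis .
qed

lemma set_expected_latency_ge:
  fixes A :: "('s, 'w, 'r::countable) implementation"
  assumes P: "2 \<le> P" and words: "uses_words P M A" and corr: "sequentially_correct P Adv A"
    and whp: "sets_complete_whp \<kappa> P Adv L A" and Adv: "Adv \<noteq> {}" and \<kappa>: "2 \<le> \<kappa>"
    and slots: "2 \<le> M * L"
  shows "some_set_expected_latency_ge P Adv A (ln (real P) / (8 * ln (real (M * L))))"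
proof -
  define K where "K = 8 * (M * L)"
  have K: "2 \<le> K" using slots unfolding K_def by linarith
  \<comment> \<open>The largest number of rounds that still leaves a process:
    \<open>P div K ^ t\<close> is positive, and \<open>P < K ^ (t + 1)\<close> bounds
    \<open>t + 1\<close> from below.\<close>
  obtain t where t: "K ^ t \<le> P" "P < K ^ (t + 1)"
    using ex_power_ivl1[OF K, of P] P by auto
  \<comment> \<open>One adversary serves to find \<open>p\<close>. As \<open>update_prob\<close>
    does not depend on it, the resulting bound holds for this \<open>p\<close> against every
    adversary in \<open>Adv\<close>.\<close>
  obtain adv where adv: "adv \<in> Adv" using Adv by blast
  obtain S where S: "S \<subseteq> {1..P}" "card S = P div K ^ t" and half: "(\<Sum>p\<in>S. update_prob P A t p) \<le> 1 / 2"
    using unlikely_updaters[OF P words whp adv \<kappa> slots] unfolding K_def by blast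
  have "0 < P div K ^ t" using t(1) K by (simp add: div_greater_zero_iff)
  then obtain p where p: "p \<in> S" using S(2) by fastforce
  have "finite S" using S(1) finite_subset by blast
  then have "update_prob P A t p \<le> (\<Sum>p\<in>S. update_prob P A t p)"
    using p by (intro member_le_sum) (auto simp: update_prob_def)
  with half have up: "update_prob P A t p \<le> 1 / 2" by simp
  have ln_slots: "ln 2 \<le> ln (real (M * L))"
    using of_nat_mono[OF slots, where 'a = real] by (intro ln_mono) auto
  then have pos: "0 < ln (real (M * L))" using ln_gt_zero[of "2::real"] by linarith
  have "ln (8::real) = 3 * ln 2" using ln_realpow[of "2::real" 3] by simp
  moreover have "ln (real K) = ln 8 + ln (real (M * L))"
  proof -
    have "0 < real (M * L)" using slots unfolding of_nat_0_less_iff by linarith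
    then have "ln (8 * real (M * L)) = ln 8 + ln (real (M * L))" by (rule ln_mult_pos[rotated]) simp
    then show ?thesis by (simp add: K_def)
  qed
  \<comment> \<open>Here \<open>ln 8 = 3 * ln 2 \<le> 3 * ln (M * L)\<close>. The factor 4 and the
    probability 1 / 2 make up the 8 in the final bound.\<close>
  ultimately have lnK: "ln (real K) \<le> 4 * ln (real (M * L))" using ln_slots by linarith
  have "real P \<le> real K ^ Suc t"
    using t(2) by (simp flip: of_nat_power of_nat_mult)
  then have "ln (real P) \<le> ln (real K ^ Suc t)" using P by (intro ln_mono) auto
  also have "\<dots> = real (Suc t) * ln (real K)" using K by (subst ln_realpow) auto
  also have "\<dots> \<le> real (Suc t) * (4 * ln (real (M * L)))" by (intro mult_left_mono lnK) simp
  finally have "ln (real P) / (8 * ln (real (M * L))) \<le> real (Suc t) / 2"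
    using pos by (simp add: field_simps)
  then have le: "ennreal (ln (real P) / (8 * ln (real (M * L)))) \<le> ennreal (real (Suc t) / 2)"
    by (rule ennreal_leI)
  have pP: "p \<in> {1..P}" using p S(1) by blast
  have "set_input {p} p = Some Set_Op" by (simp add: set_input_def)
  moreover have "ennreal (ln (real P) / (8 * ln (real (M * L)))) \<le> expected_latency P A adv' (set_input {p}) p"
    if "adv' \<in> Adv" for adv'
    using expected_latency_solo_ge[OF P pP corr that up] le by (rule order_trans[rotated])
  ultimately show ?thesis unfolding some_set_expected_latency_ge_def using pP by blast
qed

section \<open>Asymptotic form of the bound\<close>

lemma some_set_expected_latency_ge_mono:
  assumes "some_set_expected_latency_ge P Adv A b" "b' \<le> b"
  shows "some_set_expected_latency_ge P Adv A b'"
  using assms unfolding some_set_expected_latency_ge_def by (meson ennreal_leI order_trans)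

lemma some_set_expected_latency_ge_0: "1 \<le> P \<Longrightarrow> some_set_expected_latency_ge P Adv A 0"
  unfolding some_set_expected_latency_ge_def
  by (intro exI[of _ "set_input {1}"] bexI[of _ 1]) (auto simp: set_input_def)

lemma uses_words_mono: "uses_words P M A \<Longrightarrow> M \<le> M' \<Longrightarrow> uses_words P M' A"
  unfolding uses_words_def by (fastforce split: instr.splits)

lemma set_expected_latency_ge_log:
  fixes A :: "('s, 'w, 'r::countable) implementation"
  assumes P: "2 \<le> P" and words: "uses_words P M A" and corr: "sequentially_correct P Adv A"
    and whp: "sets_complete_whp \<kappa> P Adv L A" and Adv: "Adv \<noteq> {}" and \<kappa>: "2 \<le> \<kappa>"
  shows "some_set_expected_latency_ge P Adv A (1 / 8 * log (real (M * L)) (real P))"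
proof (cases "2 \<le> M * L")
  case True
  from set_expected_latency_ge[OF P words corr whp Adv \<kappa> this]
  show ?thesis by (simp add: log_def)
next
  case False
  then have "M * L = 0 \<or> M * L = 1" by linarith
  \<comment> \<open>A logarithm to base 0 or 1 evaluates to 0, so the bound is trivial.\<close>
  then have "log (real (M * L)) (real P) = 0" by (auto simp: log_def)
  then show ?thesis using some_set_expected_latency_ge_0[of P Adv A] P by simp
qed

lemma eventually_ln_ge: "\<forall>\<^sub>F P in sequentially. (x::real) \<le> ln (real P)"
proof -
  have "filterlim (\<lambda>P. ln (real P)) at_top sequentially"
    by (rule filterlim_compose[OF ln_at_top filterlim_real_sequentially])
  then show ?thesis by (simp add: filterlim_at_top)
qed

text \<open>The product is of order \<open>ln P ^ (2 * k)\<close>; one more factor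
  \<open>ln P\<close> eventually exceeds the hidden constant.\<close>

lemma polylog_slots:
  fixes M L :: "nat \<Rightarrow> nat"
  assumes "(\<lambda>P. real (M P)) \<in> O(\<lambda>P. ln (real P) ^ k)" "(\<lambda>P. real (L P)) \<in> O(\<lambda>P. ln (real P) ^ k)"
  shows "\<forall>\<^sub>F P in sequentially. real (Suc (M P) * L P) \<le> ln (real P) ^ Suc (2 * k)"
proof -
  have "(\<lambda>P. 1) \<in> O(\<lambda>P. ln (real P) ^ k)"
    by (rule bigoI[of _ 1]) (use eventually_ln_ge[of 1] in \<open>auto elim!: eventually_mono simp: power_abs intro!: one_le_power\<close>)
  from sum_in_bigo(1)[OF assms(1) this]
  have "(\<lambda>P. real (Suc (M P))) \<in> O(\<lambda>P. ln (real P) ^ k)" by (simp add: add.commute)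
  from landau_o.big_mult[OF this assms(2)]
  obtain C where C: "\<forall>\<^sub>F P in sequentially. norm (real (Suc (M P)) * real (L P)) \<le>
      C * norm (ln (real P) ^ k * ln (real P) ^ k)"
    by (rule landau_o.bigE)
  show ?thesis
    using C eventually_ln_ge[of C] eventually_ln_ge[of 1]
  proof eventually_elim
    case (elim P)
    have "real (Suc (M P) * L P) \<le> C * ln (real P) ^ (2 * k)"
      using elim(1) by (simp add: mult_2 power_add distrib_right)
    also have "\<dots> \<le> ln (real P) * ln (real P) ^ (2 * k)"
      using elim by (intro mult_right_mono) auto
    finally show ?case by simp
  qed
qed

theorem theorem7p1:
  shows "\<exists>\<kappa>\<^sub>0::real. \<forall>\<kappa>\<ge>\<kappa>\<^sub>0.
    \<forall>(A :: nat \<Rightarrow> ('s, 'w, 'r::countable) implementation) (Adv :: ('s, 'w) adversary set)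
      (M :: nat \<Rightarrow> nat) (L :: nat \<Rightarrow> nat).
      Adv \<noteq> {} \<longrightarrow>
      (\<forall>P\<ge>1. uses_words P (M P) (A P) \<and> sequentially_correct P Adv (A P) \<and>
              sets_complete_whp \<kappa> P Adv (L P) (A P)) \<longrightarrow>
      (\<lambda>P. real (L P)) \<in> \<Omega>(\<lambda>P. ln (real P)) \<longrightarrow>
      (\<exists>c>0. \<forall>\<^sub>F P in sequentially.
         some_set_expected_latency_ge P Adv (A P) (c * log (real (M P * L P)) (real P))) \<and>
      ((\<exists>k::nat. (\<lambda>P. real (M P)) \<in> O(\<lambda>P. ln (real P) ^ k) \<and>
                 (\<lambda>P. real (L P)) \<in> O(\<lambda>P. ln (real P) ^ k)) \<longrightarrow>
       (\<exists>c>0. \<forall>\<^sub>F P in sequentially.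
          some_set_expected_latency_ge P Adv (A P) (c * (ln (real P) / ln (ln (real P))))))"
proof (intro exI[of _ 2] allI impI)
  fix \<kappa> :: real and A :: "nat \<Rightarrow> ('s, 'w, 'r) implementation" and Adv :: "('s, 'w) adversary set"
    and M L :: "nat \<Rightarrow> nat"
  assume \<kappa>: "2 \<le> \<kappa>" and Adv: "Adv \<noteq> {}"
    and A: "\<forall>P\<ge>1. uses_words P (M P) (A P) \<and> sequentially_correct P Adv (A P) \<and>
              sets_complete_whp \<kappa> P Adv (L P) (A P)"
    and L: "(\<lambda>P. real (L P)) \<in> \<Omega>(\<lambda>P. ln (real P))"
  have words: "uses_words P (M P) (A P)" and corr: "sequentially_correct P Adv (A P)"
    and whp: "sets_complete_whp \<kappa> P Adv (L P) (A P)" if "2 \<le> P" for P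
    using A that by auto
  have "\<forall>\<^sub>F P in sequentially. some_set_expected_latency_ge P Adv (A P) (1 / 8 * log (real (M P * L P)) (real P))"
    by (rule eventually_sequentiallyI[of 2])
      (rule set_expected_latency_ge_log[OF _ words corr whp Adv \<kappa>])
  then have "\<exists>c>0. \<forall>\<^sub>F P in sequentially.
      some_set_expected_latency_ge P Adv (A P) (c * log (real (M P * L P)) (real P))"
    by (intro exI[of _ "1 / 8"]) simp
  moreover have "\<exists>c>0. \<forall>\<^sub>F P in sequentially.
      some_set_expected_latency_ge P Adv (A P) (c * (ln (real P) / ln (ln (real P))))"
    if k: "(\<lambda>P. real (M P)) \<in> O(\<lambda>P. ln (real P) ^ k)" "(\<lambda>P. real (L P)) \<in> O(\<lambda>P. ln (real P) ^ k)" for k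
  proof (intro exI conjI)
    \<comment> \<open>The 8 is that of \<open>set_expected_latency_ge\<close>, and
      \<open>Suc (2 * k)\<close> is the exponent in \<open>polylog_slots\<close>, which the
      logarithm turns into a factor.\<close>
    show "0 < 1 / (8 * real (Suc (2 * k)))" by simp
    obtain d where d: "0 < d" "\<forall>\<^sub>F P in sequentially. norm (real (L P)) \<ge> d * norm (ln (real P))"
      by (rule landau_omega.bigE[OF L])
    show "\<forall>\<^sub>F P in sequentially. some_set_expected_latency_ge P Adv (A P)
        (1 / (8 * real (Suc (2 * k))) * (ln (real P) / ln (ln (real P))))"
      using polylog_slots[OF k] d(2) eventually_ln_ge[of "2 / d"] eventually_ln_ge[of 2] eventually_ge_at_top[of 2]
    proof eventually_elim
      case (elim P)
      \<comment> \<open>The lower bound on \<open>L\<close> ensures that there are eventually at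
        least two slots.\<close>
      have "2 \<le> d * ln (real P)" using elim(3) d(1) by (simp add: field_simps)
      also have "\<dots> \<le> real (L P)" using elim(2,4) by simp
      finally have "2 \<le> L P" by linarith
      \<comment> \<open>\<open>Suc (M P)\<close> instead of \<open>M P\<close> excludes an empty memory, for which the logarithm is junk.\<close>
      then have slots: "2 \<le> Suc (M P) * L P" by simp
      have "ln 2 \<le> ln (real (Suc (M P) * L P))"
        using of_nat_mono[OF slots, where 'a = real] by (intro ln_mono) auto
      then have pos: "0 < ln (real (Suc (M P) * L P))" using ln_gt_zero[of "2::real"] by linarith
      have "ln (real (Suc (M P) * L P)) \<le> ln (ln (real P) ^ Suc (2 * k))"
        using elim(1) slots by (intro ln_mono) (auto simp del: of_nat_mult of_nat_Suc)
      also have "\<dots> = real (Suc (2 * k)) * ln (ln (real P))"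
        by (rule ln_realpow)
      finally have le: "ln (real P) / (8 * (real (Suc (2 * k)) * ln (ln (real P)))) \<le>
          ln (real P) / (8 * ln (real (Suc (M P) * L P)))"
        using pos elim(4) by (intro divide_left_mono mult_pos_pos mult_left_mono) auto
      have "some_set_expected_latency_ge P Adv (A P) (ln (real P) / (8 * ln (real (Suc (M P) * L P))))"
        using elim(5) by (intro set_expected_latency_ge[OF _ uses_words_mono[OF words] corr whp Adv \<kappa> slots]) auto
      then show ?case
        by (rule some_set_expected_latency_ge_mono) (use le in \<open>simp only: times_divide_times_eq mult_1 mult.assoc\<close>)
    qed
  qed
  ultimately show "(\<exists>c>0. \<forall>\<^sub>F P in sequentially.
         some_set_expected_latency_ge P Adv (A P) (c * log (real (M P * L P)) (real P))) \<and>
      ((\<exists>k::nat. (\<lambda>P. real (M P)) \<in> O(\<lambda>P. ln (real P) ^ k) \<and>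
                 (\<lambda>P. real (L P)) \<in> O(\<lambda>P. ln (real P) ^ k)) \<longrightarrow>
       (\<exists>c>0. \<forall>\<^sub>F P in sequentially.
          some_set_expected_latency_ge P Adv (A P) (c * (ln (real P) / ln (ln (real P))))))"
    by blast
qed

end
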